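(* For $X\in T\Sigma$ and $A,B\in\{1,\dots,p\}$ it holds that $$\bar g\big(\mathcal B_B(N_A),X\big)=\gamma^2(D_X)_{AB}.$$
   Context: Setting: $n\ge2$, $p\ge1$, $m=n+p$; $\Sigma$ is an $n$-dimensional manifold embedded in an $m$-dimensional Riemannian manifold $(M,\bar g)$, with the induced metric. Local coordinates on $M$ are $x^1,\dots,x^m$, on $\Sigma$ they are $u^1,\dots,u^n$, and the $x^i$ are regarded as functions of the $u^a$. Repeated indices are summed. $\partial_a=\partial/\partial u^a$, $e_a=(\partial_ax^i)\partial_i$, $g_{ab}=\bar g(e_a,e_b)$, $g=\det(g_{ab})$. $N_1,\dots,N_p$ is a local orthonormal frame of normal vector fields. $\bar\nabla$ is the Levi-Civita connection of $M$, $\bar\nabla_a=\bar\nabla_{e_a}$. For $X\in T\Sigma$, $D_XN_A$ is the normal component of $\bar\nabla_XN_A$, and $(D_X)_{AB}$ is defined by $D_XN_A=\sum_{B=1}^p(D_X)_{AB}N_B$. $\rho$ is an arbitrary non-vanishing density on $\Sigma$, $\gamma=\sqrt g/\rho$, and the Nambu bracket is $\{f_1,\dots,f_n\}=\frac1\rho\varepsilon^{a_1\cdots a_n}(\partial_{a_1}f_1)\cdots(\partial_{a_n}f_n)$. For multi-indices $I=i_1\cdots i_{n-1}$, $\vec a=a_1\cdots a_{n-1}$: $\partial_{\vec a}\vec x^I=(\partial_{a_1}x^{i_1})\cdots(\partial_{a_{n-1}}x^{i_{n-1}})$, $\bar g_{IJ}=\bar g_{i_1j_1}\cdots\bar g_{i_{n-1}j_{n-1}}$,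 $$\mathcal P^{iJ}=\frac1{\sqrt{(n-1)!}}\{x^i,x^{j_1},\dots,x^{j_{n-1}}\},\quad\mathcal T_A^{Ij}=\frac{(-1)^n}{\sqrt{(n-1)!}}\frac{\varepsilon^{\vec aa}}\rho(\partial_{\vec a}\vec x^I)(\bar\nabla_aN_A)^j,\quad(\mathcal B_A)^{ik}=\mathcal P^{iI}\mathcal T_A^{Jk}\bar g_{IJ},$$ and $\mathcal B_A:TM\to TM$ (at points of $\Sigma$) is $\mathcal B_A(X)^i=(\mathcal B_A)^{ik}\bar g_{kj}X^j$. *)

theory Defs
  imports "HOL-Analysis.Analysis"
begin

section \<open>Partial derivatives and smooth functions\<close>

definition partial :: "'n::finite \<Rightarrow> (real^'n \<Rightarrow> 'b::real_normed_vector) \<Rightarrow> real^'n \<Rightarrow> 'b" where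
  "partial a f u = vector_derivative (\<lambda>t. f (u + t *\<^sub>R axis a 1)) (at 0)"

primrec Ck_on :: "nat \<Rightarrow> (real^'n::finite \<Rightarrow> 'b::real_normed_vector) \<Rightarrow> (real^'n) set \<Rightarrow> bool" where
  "Ck_on 0 f S \<longleftrightarrow> continuous_on S f"
| "Ck_on (Suc k) f S \<longleftrightarrow> (\<forall>u\<in>S. f differentiable at u) \<and> (\<forall>a. Ck_on k (partial a f) S)"

text \<open>Only used for open sets \<^term>\<open>S\<close>.\<close>

definition smooth_on :: "(real^'n::finite) set \<Rightarrow> (real^'n \<Rightarrow> 'b::real_normed_vector) \<Rightarrow> bool" where
  "smooth_on S f \<longleftrightarrow> (\<forall>k. Ck_on k f S)"

section \<open>Manifolds, metrics, embeddings\<close>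

text \<open>A chart is a pair of its domain and its coordinate map; the values of the coordinate
  map outside the domain carry no meaning. Tensorial objects are families of components, one
  for each chart of the atlas, subject to the usual transformation laws.\<close>

type_synonym ('a, 'm) chart = "'a set \<times> ('a \<Rightarrow> real^'m)"

definition chart_inv :: "('a, 'm) chart \<Rightarrow> real^'m \<Rightarrow> 'a" where
  "chart_inv c = inv_into (fst c) (snd c)"

definition transition :: "('a, 'm) chart \<Rightarrow> ('a, 'm) chart \<Rightarrow> real^'m \<Rightarrow> real^'m" where
  "transition c c' = snd c' \<circ> chart_inv c"

definition smooth_manifold :: "'a topology \<Rightarrow> ('a, 'm::finite) chart set \<Rightarrow> bool" where
  "smooth_manifold M \<A> \<longleftrightarrow>
     Hausdorff_space M \<and> second_countable M \<and>
     (\<Union>c\<in>\<A>. fst c) = topspace M \<and>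
     (\<forall>c\<in>\<A>. openin M (fst c) \<and> open (snd c ` fst c) \<and>
        homeomorphic_map (subtopology M (fst c)) (top_of_set (snd c ` fst c)) (snd c)) \<and>
     (\<forall>c\<in>\<A>. \<forall>c'\<in>\<A>. smooth_on (snd c ` (fst c \<inter> fst c')) (transition c c'))"

definition metric_form :: "real^'m^'m \<Rightarrow> real^'m \<Rightarrow> real^'m::finite \<Rightarrow> real" where
  "metric_form G v w = (\<Sum>i\<in>UNIV. \<Sum>j\<in>UNIV. G $ i $ j * v $ i * w $ j)"

text \<open>\<^term>\<open>G c y\<close> is the matrix of components of the metric in the chart \<^term>\<open>c\<close> at the point
  with coordinates \<^term>\<open>y\<close>.\<close>

definition riemannian_metric ::
    "('a, 'm::finite) chart set \<Rightarrow> (('a, 'm) chart \<Rightarrow> real^'m \<Rightarrow> real^'m^'m) \<Rightarrow> bool" where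
  "riemannian_metric \<A> G \<longleftrightarrow>
     (\<forall>c\<in>\<A>. smooth_on (snd c ` fst c) (G c)) \<and>
     (\<forall>c\<in>\<A>. \<forall>y \<in> snd c ` fst c. transpose (G c y) = G c y \<and>
        (\<forall>v. v \<noteq> 0 \<longrightarrow> metric_form (G c y) v v > 0)) \<and>
     (\<forall>c\<in>\<A>. \<forall>c'\<in>\<A>. \<forall>y \<in> snd c ` (fst c \<inter> fst c').
        let J = jacobian (transition c c') (at y)
        in G c y = transpose J ** G c' (transition c c' y) ** J)"

text \<open>The coordinates \<open>x\<^sup>i\<close> of the chart \<^term>\<open>c\<close> of the ambient manifold as functions of the
  coordinates \<open>u\<^sup>a\<close> of the chart \<^term>\<open>d\<close> of the submanifold.\<close>

definition local_rep ::
    "('b \<Rightarrow> 'a) \<Rightarrow> ('a, 'm) chart \<Rightarrow> ('b, 'n) chart \<Rightarrow> real^'n \<Rightarrow> real^'m" where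
  "local_rep \<iota> c d = snd c \<circ> \<iota> \<circ> chart_inv d"

definition smooth_embedding ::
    "'b topology \<Rightarrow> ('b, 'n::finite) chart set \<Rightarrow> 'a topology \<Rightarrow> ('a, 'm::finite) chart set \<Rightarrow> ('b \<Rightarrow> 'a) \<Rightarrow> bool"
  where
  "smooth_embedding S \<B> M \<A> \<iota> \<longleftrightarrow>
     embedding_map S M \<iota> \<and>
     (\<forall>c\<in>\<A>. \<forall>d\<in>\<B>. let V = snd d ` {q \<in> fst d. \<iota> q \<in> fst c}; x = local_rep \<iota> c d in
        smooth_on V x \<and> (\<forall>u\<in>V. inj ((*v) (jacobian x (at u)))))"

definition nonvanishing_density ::
    "('b, 'n::finite) chart set \<Rightarrow> (('b, 'n) chart \<Rightarrow> real^'n \<Rightarrow> real) \<Rightarrow> bool" where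
  "nonvanishing_density \<B> \<rho> \<longleftrightarrow>
     (\<forall>d\<in>\<B>. \<forall>u \<in> snd d ` fst d. \<rho> d u \<noteq> 0) \<and>
     (\<forall>d\<in>\<B>. \<forall>d'\<in>\<B>. \<forall>u \<in> snd d ` (fst d \<inter> fst d').
        \<rho> d u = \<bar>det (jacobian (transition d d') (at u))\<bar> * \<rho> d' (transition d d' u))"

section \<open>Geometry in local coordinates\<close>

text \<open>From here on \<^term>\<open>G\<close> is the metric of the ambient manifold in a fixed chart, \<^term>\<open>x\<close> is
  the embedding in local coordinates, \<^term>\<open>r\<close> is the density in a chart of the submanifold, and
  vector fields along the submanifold are functions of the coordinates \<^term>\<open>u\<close> of the
  submanifold.\<close>

definition induced_metric ::
    "(real^'m \<Rightarrow> real^'m^'m) \<Rightarrow> (real^'n \<Rightarrow> real^'m) \<Rightarrow> real^'n \<Rightarrow> real^'n^'n" where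
  "induced_metric G x u = (\<chi> a b. metric_form (G (x u)) (partial a x u) (partial b x u))"

definition density_ratio ::
    "(real^'m \<Rightarrow> real^'m^'m) \<Rightarrow> (real^'n \<Rightarrow> real^'m) \<Rightarrow> (real^'n \<Rightarrow> real) \<Rightarrow> real^'n \<Rightarrow> real" where
  "density_ratio G x r u = sqrt (det (induced_metric G x u)) / r u"

definition christoffel :: "(real^'m \<Rightarrow> real^'m^'m) \<Rightarrow> real^'m \<Rightarrow> 'm \<Rightarrow> 'm \<Rightarrow> 'm \<Rightarrow> real" where
  "christoffel G y i j k = 1/2 * (\<Sum>l\<in>UNIV. matrix_inv (G y) $ i $ l *
     (partial j (\<lambda>z. G z $ l $ k) y + partial k (\<lambda>z. G z $ l $ j) y - partial l (\<lambda>z. G z $ j $ k) y))"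

text \<open>The Levi-Civita derivative along \<open>e\<^sub>a\<close> of a vector field \<^term>\<open>V\<close> along the submanifold.\<close>

definition cov_deriv ::
    "(real^'m \<Rightarrow> real^'m^'m) \<Rightarrow> (real^'n \<Rightarrow> real^'m) \<Rightarrow> 'n \<Rightarrow> (real^'n \<Rightarrow> real^'m) \<Rightarrow> real^'n \<Rightarrow> real^'m"
  where
  "cov_deriv G x a V u = (\<chi> i. partial a (\<lambda>v. V v $ i) u +
     (\<Sum>j\<in>UNIV. \<Sum>k\<in>UNIV. christoffel G (x u) i j k * partial a (\<lambda>v. x v $ j) u * V u $ k))"

definition tangent_space :: "(real^'n \<Rightarrow> real^'m) \<Rightarrow> real^'n \<Rightarrow> (real^'m) set" where
  "tangent_space x u = span (range (\<lambda>a. partial a x u))"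

definition tangent_vector :: "(real^'n \<Rightarrow> real^'m) \<Rightarrow> real^'n \<Rightarrow> real^'n \<Rightarrow> real^'m" where
  "tangent_vector x u \<xi> = (\<Sum>a\<in>UNIV. \<xi> $ a *\<^sub>R partial a x u)"

definition normal_component ::
    "(real^'m \<Rightarrow> real^'m^'m) \<Rightarrow> (real^'n \<Rightarrow> real^'m) \<Rightarrow> real^'n \<Rightarrow> real^'m \<Rightarrow> real^'m" where
  "normal_component G x u v = (THE w. v - w \<in> tangent_space x u \<and>
     (\<forall>t \<in> tangent_space x u. metric_form (G (x u)) w t = 0))"

text \<open>\<open>D\<^sub>X V\<close> for the tangent vector \<open>X = \<xi>\<^sup>a e\<^sub>a\<close> at \<^term>\<open>u\<close> and its coefficients
  \<open>(D\<^sub>X)\<^sub>A\<^sub>B\<close> with respect to a normal frame \<^term>\<open>N\<close>.\<close>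

definition normal_deriv ::
    "(real^'m \<Rightarrow> real^'m^'m) \<Rightarrow> (real^'n \<Rightarrow> real^'m) \<Rightarrow> real^'n \<Rightarrow> (real^'n \<Rightarrow> real^'m) \<Rightarrow> real^'n \<Rightarrow> real^'m"
  where
  "normal_deriv G x \<xi> V u =
     normal_component G x u (\<Sum>a\<in>UNIV. \<xi> $ a *\<^sub>R cov_deriv G x a V u)"

definition normal_conn ::
    "(real^'m \<Rightarrow> real^'m^'m) \<Rightarrow> (real^'n \<Rightarrow> real^'m) \<Rightarrow> ('p::finite \<Rightarrow> real^'n \<Rightarrow> real^'m) \<Rightarrow>
     real^'n \<Rightarrow> real^'n \<Rightarrow> 'p \<Rightarrow> 'p \<Rightarrow> real" where
  "normal_conn G x N \<xi> u A =
     (THE c. normal_deriv G x \<xi> (N A) u = (\<Sum>B\<in>UNIV. c B *\<^sub>R N B u))"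

text \<open>\<^term>\<open>N A c q\<close> is the vector of components, in the chart \<^term>\<open>c\<close> of the ambient manifold,
  of the field \<open>N\<^sub>A\<close> at the point \<^term>\<open>q\<close> of the submanifold; \<^term>\<open>W\<close> is the domain of the
  frame.\<close>

definition normal_frame ::
    "'b topology \<Rightarrow> ('b, 'n::finite) chart set \<Rightarrow> ('a, 'm::finite) chart set \<Rightarrow>
     (('a, 'm) chart \<Rightarrow> real^'m \<Rightarrow> real^'m^'m) \<Rightarrow> ('b \<Rightarrow> 'a) \<Rightarrow> 'b set \<Rightarrow>
     ('p::finite \<Rightarrow> ('a, 'm) chart \<Rightarrow> 'b \<Rightarrow> real^'m) \<Rightarrow> bool" where
  "normal_frame S \<B> \<A> G \<iota> W N \<longleftrightarrow>
     openin S W \<and>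
     (\<forall>A. \<forall>c\<in>\<A>. \<forall>d\<in>\<B>.
        smooth_on (snd d ` {q \<in> fst d \<inter> W. \<iota> q \<in> fst c}) (\<lambda>u. N A c (chart_inv d u))) \<and>
     (\<forall>A. \<forall>c\<in>\<A>. \<forall>c'\<in>\<A>. \<forall>q\<in>W. \<iota> q \<in> fst c \<inter> fst c' \<longrightarrow>
        N A c' q = jacobian (transition c c') (at (snd c (\<iota> q))) *v N A c q) \<and>
     (\<forall>A B. \<forall>c\<in>\<A>. \<forall>q\<in>W. \<iota> q \<in> fst c \<longrightarrow>
        metric_form (G c (snd c (\<iota> q))) (N A c q) (N B c q) = (if A = B then 1 else 0)) \<and>
     (\<forall>A. \<forall>c\<in>\<A>. \<forall>d\<in>\<B>. \<forall>q \<in> fst d \<inter> W. \<iota> q \<in> fst c \<longrightarrow>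
        (\<forall>t \<in> tangent_space (local_rep \<iota> c d) (snd d q).
           metric_form (G c (snd c (\<iota> q))) (N A c q) t = 0))"

section \<open>Nambu brackets and the associated tensors\<close>

text \<open>Multi-indices are lists. The coordinates \<open>u\<^sup>1, \<dots>, u\<^sup>n\<close> are ordered by the linear order of
  the index type, and \<open>\<epsilon>\<close> is normalised to be \<open>1\<close> on the increasing list.\<close>

definition multi_indices :: "nat \<Rightarrow> 'k list set" where
  "multi_indices l = {I. length I = l}"

definition levi_civita :: "'n::{finite,linorder} list \<Rightarrow> real" where
  "levi_civita as = (if distinct as \<and> length as = CARD('n)
     then (-1) ^ card {(k, l). k < l \<and> l < length as \<and> as ! l < as ! k} else 0)"

definition nambu_bracket ::
    "(real^'n::{finite,linorder} \<Rightarrow> real) \<Rightarrow> (real^'n::{finite,linorder} \<Rightarrow> real) list \<Rightarrow> real^'n::{finite,linorder} \<Rightarrow> real" where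
  "nambu_bracket r fs u = 1 / r u *
     (\<Sum>as\<in>multi_indices CARD('n). levi_civita as * (\<Prod>k<CARD('n). partial (as ! k) (fs ! k) u))"

definition P_tensor ::
    "(real^'n::{finite,linorder} \<Rightarrow> real^'m) \<Rightarrow> (real^'n::{finite,linorder} \<Rightarrow> real) \<Rightarrow> real^'n::{finite,linorder} \<Rightarrow> 'm \<Rightarrow> 'm list \<Rightarrow> real" where
  "P_tensor x r u i J = 1 / sqrt (fact (CARD('n) - 1)) *
     nambu_bracket r (map (\<lambda>j v. x v $ j) (i # J)) u"

definition partial_multi ::
    "(real^'n::{finite,linorder} \<Rightarrow> real^'m) \<Rightarrow> real^'n::{finite,linorder} \<Rightarrow> 'n list \<Rightarrow> 'm list \<Rightarrow> real" where
  "partial_multi x u as I = (\<Prod>k<CARD('n) - 1. partial (as ! k) (\<lambda>v. x v $ (I ! k)) u)"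

definition T_tensor ::
    "(real^'m \<Rightarrow> real^'m^'m) \<Rightarrow> (real^'n::{finite,linorder} \<Rightarrow> real^'m) \<Rightarrow> (real^'n::{finite,linorder} \<Rightarrow> real) \<Rightarrow>
     (real^'n::{finite,linorder} \<Rightarrow> real^'m) \<Rightarrow> real^'n::{finite,linorder} \<Rightarrow> 'm list \<Rightarrow> 'm \<Rightarrow> real" where
  "T_tensor G x r V u I j = (-1) ^ CARD('n) / sqrt (fact (CARD('n) - 1)) *
     (\<Sum>as\<in>multi_indices (CARD('n) - 1). \<Sum>a\<in>UNIV.
        levi_civita (as @ [a]) / r u * partial_multi x u as I * cov_deriv G x a V u $ j)"

definition metric_multi :: "nat \<Rightarrow> real^'m^'m \<Rightarrow> 'm list \<Rightarrow> 'm list \<Rightarrow> real" where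
  "metric_multi l G I J = (\<Prod>k<l. G $ (I ! k) $ (J ! k))"

definition B_tensor ::
    "(real^'m \<Rightarrow> real^'m^'m) \<Rightarrow> (real^'n::{finite,linorder} \<Rightarrow> real^'m) \<Rightarrow> (real^'n::{finite,linorder} \<Rightarrow> real) \<Rightarrow>
     (real^'n::{finite,linorder} \<Rightarrow> real^'m) \<Rightarrow> real^'n::{finite,linorder} \<Rightarrow> 'm \<Rightarrow> 'm \<Rightarrow> real" where
  "B_tensor G x r V u i k =
     (\<Sum>I\<in>multi_indices (CARD('n) - 1). \<Sum>J\<in>multi_indices (CARD('n) - 1).
        P_tensor x r u i I * T_tensor G x r V u J k * metric_multi (CARD('n) - 1) (G (x u)) I J)"

definition B_map ::
    "(real^'m \<Rightarrow> real^'m^'m) \<Rightarrow> (real^'n::{finite,linorder} \<Rightarrow> real^'m) \<Rightarrow> (real^'n::{finite,linorder} \<Rightarrow> real) \<Rightarrow>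
     (real^'n::{finite,linorder} \<Rightarrow> real^'m) \<Rightarrow> real^'n::{finite,linorder} \<Rightarrow> real^'m \<Rightarrow> real^'m" where
  "B_map G x r V u X =
     (\<chi> i. \<Sum>k\<in>UNIV. \<Sum>j\<in>UNIV. B_tensor G x r V u i k * G (x u) $ k $ j * X $ j)"

end

theory Submission
  imports Defs
begin

text \<open>Contracting the multi-indices with the metric turns \<open>\<B>\<^sub>B(N\<^sub>A)\<close> into a double sum over
  \<open>\<epsilon>\<close>-symbols and products of entries of the induced metric. Moving the last index of the \<open>\<epsilon>\<close> in
  \<open>\<T>\<^sub>B\<close> to the front costs a sign \<open>(-1)\<^sup>n\<^sup>-\<^sup>1\<close>, so that the pairing with \<open>X = \<xi>\<^sup>a e\<^sub>a\<close> is a cofactor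
  expansion equal to \<open>-\<gamma>\<^sup>2 g(\<nabla>\<^sub>X N\<^sub>B, N\<^sub>A)\<close>. Since \<open>g(N\<^sub>A, N\<^sub>B)\<close> is constant, metric compatibility
  turns this into \<open>\<gamma>\<^sup>2 g(\<nabla>\<^sub>X N\<^sub>A, N\<^sub>B)\<close>, and the dimension count \<open>m = n + p\<close> identifies
  \<open>g(\<nabla>\<^sub>X N\<^sub>A, N\<^sub>B)\<close> with \<open>(D\<^sub>X)\<^sub>A\<^sub>B\<close>.\<close>

section \<open>Signs of index lists\<close>

definition order_sign :: "'a::linorder \<Rightarrow> 'a \<Rightarrow> real" where
  "order_sign a b = (if a < b then 1 else if b < a then -1 else 0)"

text \<open>Product of \<open>order_sign\<close> over all pairs of positions: the sign of the
  sorting permutation of a distinct list, and 0 otherwise. Unlike \<open>levi_civita\<close> it has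
  no length condition and no count of inversions, so list induction applies directly.\<close>

primrec list_sign :: "'a::linorder list \<Rightarrow> real" where
  "list_sign [] = 1"
| "list_sign (a # as) = prod_list (map (order_sign a) as) * list_sign as"

lemma order_sign_same [simp]: "order_sign a a = 0"
  by (simp add: order_sign_def)

lemma order_sign_swap: "order_sign b a = - order_sign a b"
  by (auto simp: order_sign_def)

lemma list_sign_append:
  "list_sign (as @ bs) =
     list_sign as * list_sign bs * prod_list (map (\<lambda>a. prod_list (map (order_sign a) bs)) as)"
  by (induction as) auto

lemma list_sign_not_distinct: "\<not> distinct as \<Longrightarrow> list_sign as = 0"
  by (induction as) (auto simp: prod_list_zero_iff intro!: image_eqI[where x = a for a])

text \<open>Only the pairs containing \<open>a\<close> change their order, and each contributes one
  sign. This rotates the derivative index of \<open>T_tensor\<close> to the front.\<close>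

lemma list_sign_cyclic: "list_sign (as @ [a]) = (-1) ^ length as * list_sign (a # as)"
proof -
  have "prod_list (map (\<lambda>b. order_sign b a) as) = (-1) ^ length as * prod_list (map (order_sign a) as)"
    by (induction as) (auto simp: order_sign_swap[of _ a])
  then show ?thesis by (simp add: list_sign_append)
qed

lemma list_sign_sorted: "sorted_wrt (<) as \<Longrightarrow> list_sign as = 1"
proof (induction as)
  case (Cons a as)
  then have "map (order_sign a) as = map (\<lambda>_. 1) as"
    by (auto simp: order_sign_def)
  then show ?case using Cons by (simp add: map_replicate_const)
qed simp

text \<open>An entry between the exchanged ones lies in two reversed pairs, whose signs cancel; only
  the pair of \<open>a\<close> and \<open>b\<close> leaves a sign. Repetitions are harmless, since
  \<open>order_sign\<close> is antisymmetric throughout.\<close>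

lemma list_sign_exchange:
  "list_sign (us @ b # vs @ a # ws) = - list_sign (us @ a # vs @ b # ws)"
proof -
  have "list_sign (b # vs @ a # ws) = - list_sign (a # vs @ b # ws)"
  proof (induction vs)
    case (Cons v vs)
    let ?p = "\<lambda>c as. prod_list (map (order_sign c) as)"
    have "list_sign (b # (v # vs) @ a # ws) =
        order_sign b v * order_sign v a * ?p v vs * ?p v ws * list_sign (b # vs @ a # ws)"
      by (simp add: mult_ac)
    also have "\<dots> = - (order_sign a v * order_sign v b * ?p v vs * ?p v ws * list_sign (a # vs @ b # ws))"
      unfolding Cons by (simp add: order_sign_swap[of v a] order_sign_swap[of v b] mult_ac)
    also have "order_sign a v * order_sign v b * ?p v vs * ?p v ws * list_sign (a # vs @ b # ws) =
        list_sign (a # (v # vs) @ b # ws)"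
      by (simp add: mult_ac)
    finally show ?case .
  qed (use order_sign_swap[of b a] in simp)
  then show ?thesis
    by (induction us) (simp_all add: mult_ac)
qed

text \<open>On distinct lists both sides are the parity of the number of inversions, and both vanish
  on a repetition. The length assumption meets the guard in \<open>levi_civita\<close>.\<close>

lemma levi_civita_eq_list_sign:
  fixes as :: "'n::{finite,linorder} list"
  assumes "length as = CARD('n)"
  shows "levi_civita as = list_sign as"
proof -
  have *: "(-1) ^ card {(k, l). k < l \<and> l < length as \<and> as ! l < as ! k} = list_sign as"
    if "distinct as" for as :: "'n list"
    using that
  proof (induction as)
    case (Cons a as)
    let ?E = "\<lambda>as :: 'n list. {(k, l). k < l \<and> l < length as \<and> as ! l < as ! k}"
    let ?Z = "{l. l < length as \<and> as ! l < a}"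
    \<comment> \<open>An inversion of \<open>a # as\<close> either starts at position 0, one for
      each later entry below \<open>a\<close>, or is an inversion of \<open>as\<close> with both
      positions shifted by one.\<close>
    have "?E (a # as) = (\<lambda>l. (0, Suc l)) ` ?Z \<union> map_prod Suc Suc ` ?E as" (is "?L = ?R")
    proof (intro set_eqI iffI)
      fix z assume "z \<in> ?L"
      then obtain k l where z: "z = (k, Suc l)" "k < Suc l" "l < length as" "as ! l < (a # as) ! k"
        by (auto simp: gr0_conv_Suc)
          (metis Suc_less_eq gr_implies_not_zero not0_implies_Suc nth_Cons_Suc)
      then show "z \<in> ?R" by (cases k) (auto simp: image_iff)
    qed auto
    moreover have "finite (?E as)"
      by (rule finite_subset[of _ "{..<length as} \<times> {..<length as}"]) auto
    ultimately have "card (?E (a # as)) = card ?Z + card (?E as)"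
      by (simp only:, subst card_Un_disjoint)
        (auto simp: card_image inj_on_def map_prod_def)
    moreover have "prod_list (map (order_sign a) as) = (-1) ^ card ?Z"
    proof -
      have "a \<notin> set as" using Cons by simp
      then have "prod_list (map (order_sign a) as) = (-1) ^ length (filter (\<lambda>b. b < a) as)"
        by (induction as) (auto simp: order_sign_def)
      then show ?thesis by (simp add: length_filter_conv_card)
    qed
    ultimately show ?case using Cons by (simp add: power_add)
  qed simp
  then show ?thesis
    using *[of as] list_sign_not_distinct[of as] assms by (cases "distinct as") (simp_all add: levi_civita_def)
qed

text \<open>Swapping two values of a distinct list exchanges the two positions that hold them, so
  \<open>list_sign_exchange\<close> applies.\<close>

lemma list_sign_transpose:
  assumes "distinct as" "a \<in> set as" "b \<in> set as" "a \<noteq> b"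
  shows "list_sign (map (Transposition.transpose a b) as) = - list_sign as"
proof -
  have *: "list_sign (map (Transposition.transpose a b) (us @ a # vs @ b # ws)) = - list_sign (us @ a # vs @ b # ws)"
    if "distinct (us @ a # vs @ b # ws)" for us vs ws and a b :: 'a
  proof -
    have "map (Transposition.transpose a b) us = us" "map (Transposition.transpose a b) vs = vs" "map (Transposition.transpose a b) ws = ws"
      using that by (auto intro!: map_idI simp: Transposition.transpose_def)
    then show ?thesis using list_sign_exchange by simp
  qed
  obtain us ws where as: "as = us @ a # ws" using assms split_list by metis
  then consider "b \<in> set us" | "b \<in> set ws" using assms by auto
  then show ?thesis
  proof cases
    case 1
    then obtain us' vs where "us = us' @ b # vs" using split_list by metis
    then show ?thesis using as *[of us' b vs a ws] assms(1) by (simp add: Transposition.transpose_commute)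
  next
    case 2
    then obtain vs ws' where "ws = vs @ b # ws'" using split_list by metis
    then show ?thesis using as *[of us a vs b ws'] assms(1) by simp
  qed
qed

abbreviation index_list :: "'n::{finite,linorder} list" where
  "index_list \<equiv> sorted_list_of_set UNIV"

text \<open>Composition with a transposition on the left flips both signs, and transpositions
  generate all permutations. This links \<open>list_sign\<close> to the \<open>sign\<close> in
  \<open>det_def\<close>.\<close>

lemma list_sign_permutes:
  fixes p :: "'n::{finite,linorder} \<Rightarrow> 'n"
  assumes "p permutes UNIV"
  shows "list_sign (map p index_list) = of_int (sign p)"
  using assms finite[of UNIV]
proof (induction p rule: permutes_induct)
  case id
  then show ?case by (simp add: list_sign_sorted sign_id)
next
  case (swap a b p)
  show ?case
  proof (cases "a = b")
    case False
    have "list_sign (map (Transposition.transpose a b) (map p index_list)) = - list_sign (map p index_list)"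
      using swap permutes_inj[of p UNIV] permutes_surj[of p UNIV] False
      by (intro list_sign_transpose) (auto simp: distinct_map inj_on_def)
    moreover have "sign (Transposition.transpose a b \<circ> p) = - sign p"
      using False swap by (subst sign_compose)
        (auto simp: sign_swap_id permutation_swap_id intro!: permutes_imp_permutation[of UNIV])
    ultimately show ?thesis using swap by (simp add: o_def)
  qed (use swap in simp)
qed

section \<open>Sums over multi-indices and determinants\<close>

lemma finite_multi_indices [simp]: "finite (multi_indices l :: 'k::finite list set)"
  using finite_lists_length_eq[of "UNIV :: 'k set"] by (simp add: multi_indices_def)

lemma sum_multi_indices_Suc:
  fixes F :: "'k::finite list \<Rightarrow> 'c::comm_monoid_add"
  shows "(\<Sum>I\<in>multi_indices (Suc l). F I) = (\<Sum>i\<in>UNIV. \<Sum>I\<in>multi_indices l. F (i # I))"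
proof -
  have "multi_indices (Suc l) = (\<lambda>(i, I). i # I) ` (UNIV \<times> multi_indices l :: ('k \<times> 'k list) set)"
    by (auto simp: multi_indices_def length_Suc_conv image_iff)
  moreover have "inj_on (\<lambda>(i, I). i # I) (UNIV \<times> multi_indices l :: ('k \<times> 'k list) set)"
    by (auto simp: inj_on_def)
  ultimately show ?thesis
    by (simp only: sum.reindex sum.cartesian_product) (simp add: o_def split_beta)
qed

text \<open>Distributive law: a multi-index is an independent choice in each slot.\<close>

lemma sum_multi_indices_prod:
  fixes f :: "nat \<Rightarrow> 'k::finite \<Rightarrow> real"
  shows "(\<Sum>I\<in>multi_indices l. \<Prod>k<l. f k (I ! k)) = (\<Prod>k<l. \<Sum>i\<in>UNIV. f k i)"
proof (induction l arbitrary: f)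
  case (Suc l)
  show ?case
    using Suc[of "\<lambda>k. f (Suc k)"]
    by (simp add: sum_multi_indices_Suc prod.lessThan_Suc_shift del: prod.lessThan_Suc flip: sum_distrib_left sum_distrib_right)
qed (simp add: multi_indices_def)

text \<open>Multi-indices of full length are the value lists of functions on the index type. Sums
  over lists thus become sums over functions, among which the permutations of the Leibniz formula
  can be singled out.\<close>

lemma bij_betw_map_index_list:
  "bij_betw (\<lambda>f. map f (index_list :: 'n::{finite,linorder} list)) UNIV (multi_indices CARD('n) :: 'k list set)"
proof (intro bij_betw_imageI inj_onI set_eqI iffI)
  fix I :: "'k list" assume I: "I \<in> multi_indices CARD('n)"
  have "bij_betw (\<lambda>k. index_list ! k) {..<CARD('n)} (UNIV :: 'n set)"
    using bij_betw_nth[of "index_list :: 'n list"] by simp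
  \<comment> \<open>The preimage of \<open>I\<close> sends an index to the entry of \<open>I\<close>
    at its position in the increasing list.\<close>
  then have "map (\<lambda>a. I ! inv_into {..<CARD('n)} (\<lambda>k. index_list ! k) a) (index_list :: 'n list) = I"
    using I by (intro nth_equalityI) (auto simp: multi_indices_def bij_betw_inv_into_left)
  then show "I \<in> range (\<lambda>f. map f (index_list :: 'n list))" by (metis rangeI)
qed (auto simp: multi_indices_def fun_eq_iff)

lemma distinct_map_index_list:
  fixes f :: "'n::{finite,linorder} \<Rightarrow> 'n"
  shows "distinct (map f index_list) \<longleftrightarrow> f permutes UNIV"
  by (auto simp: distinct_map permutes_inj bij_def finite_UNIV_inj_surj intro!: bij_imp_permutes)

lemma prod_index_list:
  fixes h :: "'n::{finite,linorder} \<Rightarrow> real"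
  shows "(\<Prod>k<CARD('n). h (index_list ! k)) = (\<Prod>i\<in>UNIV. h i)"
proof -
  have "bij_betw (\<lambda>k. index_list ! k) {..<CARD('n)} (UNIV :: 'n set)"
    using bij_betw_nth[of "index_list :: 'n list"] by simp
  then show ?thesis by (rule prod.reindex_bij_betw)
qed

text \<open>Leibniz formula for the matrix whose rows are the columns of \<open>M\<close> selected
  by \<open>cs\<close>. If \<open>cs\<close> is a permutation, reordering the rows gives its sign; a
  repetition in \<open>cs\<close> gives two equal rows.\<close>

lemma sum_list_sign_prod:
  fixes M :: "real^('n::{finite,linorder})^('n::{finite,linorder})" and cs :: "'n list"
  assumes "length cs = CARD('n)"
  shows "(\<Sum>bs\<in>multi_indices CARD('n). list_sign bs * (\<Prod>k<CARD('n). M $ (bs ! k) $ (cs ! k))) =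
         det M * list_sign cs"
proof -
  obtain f :: "'n \<Rightarrow> 'n" where cs: "cs = map f index_list"
    using bij_betw_map_index_list[where 'n = 'n and 'k = 'n] assms
    by (auto simp: bij_betw_def multi_indices_def)
  let ?F = "\<lambda>p. list_sign (map p index_list) * (\<Prod>i\<in>UNIV. M $ p i $ f i)"
  have "(\<Sum>bs\<in>multi_indices CARD('n). list_sign bs * (\<Prod>k<CARD('n). M $ (bs ! k) $ (cs ! k))) =
      (\<Sum>p\<in>UNIV. ?F p)"
    by (simp add: sum.reindex_bij_betw[OF bij_betw_map_index_list, symmetric] cs flip: prod_index_list)
  \<comment> \<open>A function that is not a permutation has a value list with a repetition, whose
    sign is 0.\<close>
  also have "\<dots> = (\<Sum>p | p permutes UNIV. ?F p)"
    using distinct_map_index_list list_sign_not_distinct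
    by (intro sum.mono_neutral_right) auto
  also have "\<dots> = det (\<chi> i. transpose M $ f i)"
    by (auto simp: det_def list_sign_permutes transpose_def intro!: sum.cong)
  also have "\<dots> = det M * list_sign cs"
  proof (cases "f permutes UNIV")
    case True
    then show ?thesis
      using det_permute_rows[OF True, of "transpose M"] by (simp add: cs list_sign_permutes)
  next
    case False
    then have "\<not> inj f" using distinct_map_index_list[of f] by (auto simp: distinct_map)
    then obtain i j where "i \<noteq> j" "f i = f j" by (auto simp: inj_def)
    then have "det (\<chi> i. transpose M $ f i) = 0"
      by (intro det_identical_rows[of i j]) (auto simp: row_def vec_eq_iff)
    then show ?thesis
      using False distinct_map_index_list[of f] list_sign_not_distinct[of cs] cs by simp
  qed
  finally show ?thesis .
qed

lemma list_sign_square: "distinct as \<Longrightarrow> list_sign as * list_sign as = 1"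
proof (induction as)
  case (Cons a as)
  have "prod_list (map (order_sign a) as) * prod_list (map (order_sign a) as) = 1"
    if "a \<notin> set as" using that by (induction as) (auto simp: order_sign_def)
  then show ?case using Cons by (simp add: mult_ac)
qed simp

text \<open>Contraction of two \<epsilon>-symbols in all but one index. For \<open>a = c\<close>
  every surviving term is 1, and the orderings of the other indices are counted; for distinct
  \<open>a\<close> and \<open>c\<close> a surviving term would need n+1 distinct indices.\<close>

lemma sum_list_sign_contract:
  fixes a c :: "'n::{finite,linorder}"
  shows "(\<Sum>as\<in>multi_indices (CARD('n) - 1). list_sign (a # as) * list_sign (c # as)) =
         (if a = c then fact (CARD('n) - 1) else 0)"
proof (cases "a = c")
  case True
  let ?D = "{as. length as = CARD('n) - 1 \<and> distinct as \<and> set as \<subseteq> UNIV - {a}}"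
  have "(\<Sum>as\<in>multi_indices (CARD('n) - 1). list_sign (a # as) * list_sign (c # as)) =
      (\<Sum>as\<in>?D. list_sign (a # as) * list_sign (a # as))"
    unfolding True
    using list_sign_not_distinct[of "c # _"]
    by (intro sum.mono_neutral_right finite_multi_indices) (auto simp: multi_indices_def)
  also have "\<dots> = (\<Sum>as\<in>?D. 1)"
    by (intro sum.cong refl list_sign_square) auto
  \<comment> \<open>The lists exhaust the complement of \<open>a\<close>, so the lower end of the
    product is 1.\<close>
  also have "\<dots> = real (\<Prod>{card (UNIV - {a}) - (CARD('n) - 1) + 1 .. card (UNIV - {a})})"
    by (subst card_lists_distinct_length_eq[symmetric]) (auto simp: card_Diff_singleton)
  also have "\<dots> = fact (CARD('n) - 1)"
    by (simp add: card_Diff_singleton fact_prod)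
  finally show ?thesis using True by simp
next
  case False
  have "list_sign (a # as) * list_sign (c # as) = 0" if "length as = CARD('n) - 1" for as
  proof (rule ccontr)
    assume "list_sign (a # as) * list_sign (c # as) \<noteq> 0"
    then have *: "distinct (a # as)" "distinct (c # as)"
      using list_sign_not_distinct by fastforce+
    then have "distinct (a # c # as)" using False by auto
    then have "length (a # c # as) = card (set (a # c # as))" using distinct_card by metis
    also have "\<dots> \<le> CARD('n)" by (intro card_mono) auto
    finally show False using that by simp
  qed
  then have "(\<Sum>as\<in>multi_indices (CARD('n) - 1). list_sign (a # as) * list_sign (c # as)) = 0"
    by (intro sum.neutral) (simp add: multi_indices_def del: list_sign.simps)
  then show ?thesis using False by simp
qed

section \<open>Bilinear forms of matrices and positive definiteness\<close>

lemma metric_form_inner: "metric_form G v w = v \<bullet> (G *v w)"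
  by (simp add: metric_form_def inner_vec_def matrix_vector_mult_def sum_distrib_left mult_ac)

lemma metric_form_simps:
  "metric_form G (v + v') w = metric_form G v w + metric_form G v' w"
  "metric_form G v (w + w') = metric_form G v w + metric_form G v w'"
  "metric_form G (v - v') w = metric_form G v w - metric_form G v' w"
  "metric_form G v (w - w') = metric_form G v w - metric_form G v w'"
  "metric_form G (a *\<^sub>R v) w = a * metric_form G v w"
  "metric_form G v (a *\<^sub>R w) = a * metric_form G v w"
  "metric_form G (\<Sum>i\<in>I. f i) w = (\<Sum>i\<in>I. metric_form G (f i) w)"
  "metric_form G v (\<Sum>i\<in>I. f i) = (\<Sum>i\<in>I. metric_form G v (f i))"
  "metric_form G 0 w = 0" "metric_form G v 0 = 0"
  by (simp_all add: metric_form_inner inner_left_distrib inner_right_distrib inner_diff_left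
      inner_diff_right inner_sum_left inner_sum_right matrix_vector_right_distrib
      matrix_vector_mult_diff_distrib matrix_vector_mult_scaleR linear_sum matrix_vector_mul_linear)

lemma metric_form_sym: "transpose G = G \<Longrightarrow> metric_form G v w = metric_form G w v"
  by (metis metric_form_inner dot_lmul_matrix inner_commute transpose_matrix_vector)

lemma metric_form_matrix_simps:
  "metric_form (G + H) v w = metric_form G v w + metric_form H v w"
  "metric_form (a *\<^sub>R G) v w = a * metric_form G v w"
  by (simp_all add: metric_form_def algebra_simps sum.distrib sum_distrib_left)

lemma metric_form_matrix_sum:
  "metric_form (\<Sum>i\<in>I. F i) v w = (\<Sum>i\<in>I. metric_form (F i) v w)"
  by (induction I rule: infinite_finite_induct)
    (simp_all add: metric_form_matrix_simps, simp_all add: metric_form_def)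

lemma invertible_of_positive:
  fixes G :: "real^'m^'m"
  assumes "\<And>v. v \<noteq> 0 \<Longrightarrow> metric_form G v v > 0"
  shows "invertible G"
proof -
  have "v = 0" if "G *v v = 0" for v
    using assms[of v] that by (auto simp: metric_form_inner)
  then show ?thesis
    using invertible_left_inverse matrix_left_invertible_ker by blast
qed

lemma matrix_inv_right_inverse:
  assumes "invertible G"
  shows "G ** matrix_inv G = mat 1"
  using someI_ex[OF assms[unfolded invertible_def]] by (simp add: matrix_inv_def)

text \<open>The determinant does not vanish on the segment from \<^term>\<open>mat 1\<close> to \<^term>\<open>G\<close>.\<close>

lemma det_positive:
  fixes G :: "real^'m^'m"
  assumes "\<And>v. v \<noteq> 0 \<Longrightarrow> metric_form G v v > 0"
  shows "det G > 0"
proof (rule ccontr)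
  assume "\<not> det G > 0"
  let ?H = "\<lambda>t. (1 - t) *\<^sub>R mat 1 + t *\<^sub>R G"
  have "continuous_on {0..1} (\<lambda>t. det (?H t))"
    unfolding det_def by (intro continuous_intros)
  then obtain t where t: "0 \<le> t" "t \<le> 1" "det (?H t) = 0"
    using IVT2'[of "\<lambda>t. det (?H t)" 1 0 0] \<open>\<not> det G > 0\<close> by auto
  have "metric_form (?H t) v v > 0" if "v \<noteq> 0" for v
  proof -
    have "metric_form (mat 1) v v > 0" using that by (simp add: metric_form_inner)
    then show ?thesis
      using assms[OF that] t(1,2)
      by (cases "t = 0") (auto simp: metric_form_matrix_simps intro!: add_nonneg_pos)
  qed
  then show False using invertible_of_positive[of "?H t"] t(3) by (simp add: invertible_det_nz)
qed

section \<open>Derivatives and tangent spaces\<close>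

lemma partial_eq_derivative:
  assumes "(f has_derivative f') (at u)"
  shows "partial a f u = f' (axis a 1)"
proof -
  have "((\<lambda>t. u + t *\<^sub>R axis a 1) has_derivative (\<lambda>t. t *\<^sub>R axis a 1)) (at 0)"
    by (auto intro!: derivative_eq_intros)
  from has_derivative_compose[OF this, of f f'] assms
  have "((\<lambda>t. f (u + t *\<^sub>R axis a 1)) has_derivative (\<lambda>t. f' (t *\<^sub>R axis a 1))) (at 0)"
    by simp
  then show ?thesis
    unfolding partial_def using has_derivative_linear[OF assms]
    by (intro vector_derivative_at) (simp add: has_vector_derivative_def linear_scale)
qed

lemma partial_component:
  assumes "f differentiable at u"
  shows "partial a (\<lambda>v. f v $ i) u = partial a f u $ i"
proof -
  obtain f' where f: "(f has_derivative f') (at u)" using assms by (auto simp: differentiable_def)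
  have "((\<lambda>v. f v $ i) has_derivative (\<lambda>h. f' h $ i)) (at u)"
    using bounded_linear.has_derivative[OF bounded_linear_vec_nth f] by simp
  then show ?thesis using f by (simp add: partial_eq_derivative)
qed

lemma linear_axis_expansion:
  fixes f :: "real^'n \<Rightarrow> 'b::real_vector"
  assumes "linear f"
  shows "f h = (\<Sum>a\<in>UNIV. h $ a *\<^sub>R f (axis a 1))"
proof -
  have "f h = f (\<Sum>a\<in>UNIV. h $ a *\<^sub>R axis a 1)"
    using basis_expansion[of h] by (simp add: scalar_mult_eq_scaleR)
  then show ?thesis using assms by (simp add: linear_sum linear_scale)
qed

lemma tangent_vector_eq_derivative:
  assumes "(x has_derivative x') (at u)"
  shows "tangent_vector x u \<xi> = x' \<xi>"
  using linear_axis_expansion[OF has_derivative_linear[OF assms], of \<xi>]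
  by (simp add: tangent_vector_def partial_eq_derivative[OF assms])

text \<open>The derivative maps the axis vectors to the coordinate fields, and these span its
  image.\<close>

lemma tangent_space_eq_range:
  assumes "(x has_derivative x') (at u)"
  shows "tangent_space x u = range x'"
proof
  have lin: "linear x'" using assms by (rule has_derivative_linear)
  show "tangent_space x u \<subseteq> range x'"
    unfolding tangent_space_def
    by (rule span_minimal) (auto simp: partial_eq_derivative[OF assms] lin intro: linear_subspace_image)
  show "range x' \<subseteq> tangent_space x u"
    unfolding tangent_space_def tangent_vector_eq_derivative[OF assms, symmetric] tangent_vector_def
    by (intro image_subsetI span_sum span_scale span_base) auto
qed

section \<open>The Levi-Civita derivative and its compatibility with the metric\<close>

lemma metric_form_axis_expansion:
  fixes D :: "real^'m \<Rightarrow> real^'m^'m"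
  assumes "linear D"
  shows "metric_form (D X) V W = (\<Sum>j\<in>UNIV. X $ j * (\<Sum>i\<in>UNIV. \<Sum>k\<in>UNIV. D (axis j 1) $ i $ k * V $ i * W $ k))"
  by (subst linear_axis_expansion[OF assms])
    (simp add: metric_form_matrix_simps metric_form_matrix_sum, simp add: metric_form_def)

text \<open>Koszul formula for the connection term: pairing with \<open>G y\<close> cancels the
  inverse matrix in the Christoffel symbols and leaves their three first derivatives of the
  metric.\<close>

lemma christoffel_koszul:
  fixes G :: "real^'m \<Rightarrow> real^'m^'m"
  assumes D: "(G has_derivative D) (at y)" and inv: "invertible (G y)"
  shows "metric_form (G y) W (\<chi> i. \<Sum>j\<in>UNIV. \<Sum>k\<in>UNIV. christoffel G y i j k * X $ j * V $ k) =
    1/2 * (metric_form (D X) W V + metric_form (D V) W X - metric_form (D W) X V)"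
proof -
  let ?dG = "\<lambda>j i k. D (axis j 1) $ i $ k"
  \<comment> \<open>Christoffel symbols of the first kind contracted with \<open>X\<close> and
    \<open>V\<close>; only the raising of the index \<open>l\<close> is missing.\<close>
  define \<kappa> :: "real^'m" where
    "\<kappa> = (\<chi> l. \<Sum>j\<in>UNIV. \<Sum>k\<in>UNIV. 1/2 * (?dG j l k + ?dG k l j - ?dG l j k) * X $ j * V $ k)"
  have dG: "partial j (\<lambda>z. G z $ i $ k) y = ?dG j i k" for i j k
  proof -
    have "((\<lambda>z. G z $ i $ k) has_derivative (\<lambda>h. D h $ i $ k)) (at y)"
      by (intro bounded_linear.has_derivative[OF bounded_linear_vec_nth] D)
    then show ?thesis by (simp add: partial_eq_derivative)
  qed
  have "(\<chi> i. \<Sum>j\<in>UNIV. \<Sum>k\<in>UNIV. christoffel G y i j k * X $ j * V $ k) = matrix_inv (G y) *v \<kappa>"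
  proof (subst vec_eq_iff, intro allI)
    fix i
    have "(\<Sum>j\<in>UNIV. \<Sum>k\<in>UNIV. christoffel G y i j k * X $ j * V $ k) =
      (\<Sum>j\<in>UNIV. \<Sum>k\<in>UNIV. \<Sum>l\<in>UNIV. matrix_inv (G y) $ i $ l *
        (1/2 * (?dG j l k + ?dG k l j - ?dG l j k) * X $ j * V $ k))"
      by (simp add: christoffel_def dG sum_distrib_left sum_distrib_right mult_ac)
    also have "\<dots> = (\<Sum>j\<in>UNIV. \<Sum>l\<in>UNIV. \<Sum>k\<in>UNIV. matrix_inv (G y) $ i $ l *
        (1/2 * (?dG j l k + ?dG k l j - ?dG l j k) * X $ j * V $ k))"
      by (intro sum.cong refl sum.swap)
    also have "\<dots> = (\<Sum>l\<in>UNIV. \<Sum>j\<in>UNIV. \<Sum>k\<in>UNIV. matrix_inv (G y) $ i $ l *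
        (1/2 * (?dG j l k + ?dG k l j - ?dG l j k) * X $ j * V $ k))"
      by (rule sum.swap)
    also have "\<dots> = (matrix_inv (G y) *v \<kappa>) $ i"
      by (simp add: matrix_vector_mult_def \<kappa>_def sum_distrib_left)
    finally show "(\<chi> i. \<Sum>j\<in>UNIV. \<Sum>k\<in>UNIV. christoffel G y i j k * X $ j * V $ k) $ i =
        (matrix_inv (G y) *v \<kappa>) $ i" by simp
  qed
  then have "metric_form (G y) W (\<chi> i. \<Sum>j\<in>UNIV. \<Sum>k\<in>UNIV. christoffel G y i j k * X $ j * V $ k) = W \<bullet> \<kappa>"
    by (simp add: metric_form_inner matrix_vector_mul_assoc matrix_inv_right_inverse[OF inv])
  \<comment> \<open>Each sum is a directional derivative of the metric once the differentiated index
    is summed outermost.\<close>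
  also have "\<dots> = 1/2 * ((\<Sum>l\<in>UNIV. \<Sum>j\<in>UNIV. \<Sum>k\<in>UNIV. ?dG j l k * W $ l * X $ j * V $ k) +
      (\<Sum>l\<in>UNIV. \<Sum>j\<in>UNIV. \<Sum>k\<in>UNIV. ?dG k l j * W $ l * X $ j * V $ k) -
      (\<Sum>l\<in>UNIV. \<Sum>j\<in>UNIV. \<Sum>k\<in>UNIV. ?dG l j k * W $ l * X $ j * V $ k))"
    by (simp add: inner_vec_def \<kappa>_def sum_distrib_left sum_subtractf[symmetric] sum.distrib[symmetric])
      (intro sum.cong refl, simp add: algebra_simps)
  also have "(\<Sum>l\<in>UNIV. \<Sum>j\<in>UNIV. \<Sum>k\<in>UNIV. ?dG j l k * W $ l * X $ j * V $ k) = metric_form (D X) W V"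
    by (subst sum.swap)
      (simp add: metric_form_axis_expansion[OF has_derivative_linear[OF D]] sum_distrib_left mult_ac)
  also have "(\<Sum>l\<in>UNIV. \<Sum>j\<in>UNIV. \<Sum>k\<in>UNIV. ?dG k l j * W $ l * X $ j * V $ k) = metric_form (D V) W X"
  proof -
    have "(\<Sum>l\<in>UNIV. \<Sum>j\<in>UNIV. \<Sum>k\<in>UNIV. ?dG k l j * W $ l * X $ j * V $ k) =
        (\<Sum>l\<in>UNIV. \<Sum>k\<in>UNIV. \<Sum>j\<in>UNIV. ?dG k l j * W $ l * X $ j * V $ k)"
      by (intro sum.cong refl sum.swap)
    also have "\<dots> = (\<Sum>k\<in>UNIV. \<Sum>l\<in>UNIV. \<Sum>j\<in>UNIV. ?dG k l j * W $ l * X $ j * V $ k)"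
      by (rule sum.swap)
    finally show ?thesis
      by (simp add: metric_form_axis_expansion[OF has_derivative_linear[OF D]] sum_distrib_left mult_ac)
  qed
  also have "(\<Sum>l\<in>UNIV. \<Sum>j\<in>UNIV. \<Sum>k\<in>UNIV. ?dG l j k * W $ l * X $ j * V $ k) = metric_form (D W) X V"
    by (simp add: metric_form_axis_expansion[OF has_derivative_linear[OF D]] sum_distrib_left mult_ac)
  finally show ?thesis .
qed


lemma has_derivative_metric_form:
  assumes "(H has_derivative H') (at u)" "(V has_derivative V') (at u)" "(W has_derivative W') (at u)"
  shows "((\<lambda>v. metric_form (H v) (V v) (W v)) has_derivative
    (\<lambda>h. metric_form (H' h) (V u) (W u) + metric_form (H u) (V' h) (W u) + metric_form (H u) (V u) (W' h))) (at u)"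
proof -
  have [derivative_intros]: "((\<lambda>v. f v $ i) has_derivative (\<lambda>h. f' h $ i)) (at u)"
    if "(f has_derivative f') (at u)" for f f' i
    using bounded_linear.has_derivative[OF bounded_linear_vec_nth that] .
  show ?thesis
    unfolding metric_form_def
    by (rule derivative_eq_intros refl assms)+
      (simp add: sum.distrib[symmetric] algebra_simps)
qed

text \<open>By \<open>christoffel_koszul\<close> the two connection terms add up to the derivative
  of the metric along the coordinate field; the other terms cancel because the derivative of a
  symmetric matrix field is symmetric. Hence symmetry is assumed near the point and not merely at
  it.\<close>

lemma cov_deriv_metric_compatible:
  fixes G :: "real^'m \<Rightarrow> real^'m^'m" and x :: "real^'n \<Rightarrow> real^'m"
  assumes G: "G differentiable at (x u)" and x: "x differentiable at u"
    and V: "V differentiable at u" and W: "W differentiable at u"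
    and sym: "\<forall>\<^sub>F y in nhds (x u). transpose (G y) = G y" and inv: "invertible (G (x u))"
  shows "partial a (\<lambda>v. metric_form (G (x v)) (V v) (W v)) u =
    metric_form (G (x u)) (cov_deriv G x a V u) (W u) + metric_form (G (x u)) (V u) (cov_deriv G x a W u)"
proof -
  obtain D x' V' W' where D: "(G has_derivative D) (at (x u))"
    and x': "(x has_derivative x') (at u)" and V': "(V has_derivative V') (at u)"
    and W': "(W has_derivative W') (at u)"
    using assms by (auto simp: differentiable_def)
  let ?X = "x' (axis a 1)"
  let ?\<Gamma> = "\<lambda>V. \<chi> i. \<Sum>j\<in>UNIV. \<Sum>k\<in>UNIV. christoffel G (x u) i j k * ?X $ j * V $ k"
  have symG: "transpose (G (x u)) = G (x u)" using sym eventually_nhds_x_imp_x by blast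
  \<comment> \<open>Near \<open>x u\<close> transposition does not change the field, so uniqueness
    of derivatives makes every \<open>D h\<close> symmetric.\<close>
  have "((\<lambda>y. transpose (G y)) has_derivative (\<lambda>h. transpose (D h))) (at (x u))"
    by (intro bounded_linear.has_derivative[OF _ D] linear_conv_bounded_linear[THEN iffD1])
      (auto simp: linear_iff transpose_def vec_eq_iff)
  moreover have "((\<lambda>y. transpose (G y)) has_derivative D) (at (x u))"
    using D sym symG
    by (rule_tac has_derivative_transform_eventually[OF D])
      (auto elim!: eventually_mono simp: eventually_at_filter)
  ultimately have symD: "transpose (D h) = D h" for h
    using has_derivative_unique by metis
  have cov: "cov_deriv G x a V u = V' (axis a 1) + ?\<Gamma> (V u)" if "(V has_derivative V') (at u)" for V V'
  proof -
    have "x differentiable at u" "V differentiable at u" using x' that by (auto simp: differentiable_def)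
    then show ?thesis
      by (simp add: vec_eq_iff cov_deriv_def partial_component partial_eq_derivative[OF x'] partial_eq_derivative[OF that])
  qed
  have "partial a (\<lambda>v. metric_form (G (x v)) (V v) (W v)) u =
      metric_form (D ?X) (V u) (W u) + metric_form (G (x u)) (V' (axis a 1)) (W u) +
      metric_form (G (x u)) (V u) (W' (axis a 1))"
    by (intro partial_eq_derivative has_derivative_metric_form[OF _ V' W', of "\<lambda>v. G (x v)" "\<lambda>h. D (x' h)"]
        has_derivative_compose[OF x' D])
  \<comment> \<open>The formula is used twice, with the two fields exchanged, so the derivatives of
    the metric along \<open>V u\<close> and \<open>W u\<close> occur with opposite signs.\<close>
  also have "metric_form (D ?X) (V u) (W u) =
      metric_form (G (x u)) (?\<Gamma> (V u)) (W u) + metric_form (G (x u)) (V u) (?\<Gamma> (W u))"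
    unfolding metric_form_sym[OF symG, of "?\<Gamma> (V u)" "W u"] christoffel_koszul[OF D inv]
    using metric_form_sym[OF symD] by (simp add: algebra_simps)
  finally show ?thesis
    by (simp add: cov[OF V'] cov[OF W'] metric_form_simps)
qed

section \<open>Contraction of \<open>P_tensor\<close> with \<open>T_tensor\<close>\<close>

text \<open>Interchange of sums for \<open>B_tensor\<close>. Here \<open>E\<close> stands for
  \<open>partial_multi\<close> and \<open>g\<close> for \<open>metric_multi\<close>, so that the
  contraction over \<open>I\<close> and \<open>J\<close> can be evaluated on its own.\<close>

lemma sum_contract:
  fixes p t :: "'q \<Rightarrow> real"
  shows "(\<Sum>I\<in>A. \<Sum>J\<in>A. (\<Sum>\<beta>\<in>Q. p \<beta> * E \<beta> I) * (\<Sum>\<alpha>\<in>Q. t \<alpha> * E \<alpha> J) * g I J) =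
    (\<Sum>\<beta>\<in>Q. \<Sum>\<alpha>\<in>Q. p \<beta> * t \<alpha> * (\<Sum>I\<in>A. \<Sum>J\<in>A. E \<beta> I * E \<alpha> J * g I J))"
proof -
  have "(\<Sum>I\<in>A. \<Sum>J\<in>A. (\<Sum>\<beta>\<in>Q. p \<beta> * E \<beta> I) * (\<Sum>\<alpha>\<in>Q. t \<alpha> * E \<alpha> J) * g I J) =
      (\<Sum>(I, J)\<in>A \<times> A. \<Sum>(\<beta>, \<alpha>)\<in>Q \<times> Q. p \<beta> * E \<beta> I * (t \<alpha> * E \<alpha> J) * g I J)"
    unfolding sum_product by (simp add: sum_distrib_right flip: sum.cartesian_product)
  also have "\<dots> = (\<Sum>(\<beta>, \<alpha>)\<in>Q \<times> Q. \<Sum>(I, J)\<in>A \<times> A. p \<beta> * E \<beta> I * (t \<alpha> * E \<alpha> J) * g I J)"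
    unfolding split_beta by (rule sum.swap)
  also have "\<dots> = (\<Sum>\<beta>\<in>Q. \<Sum>\<alpha>\<in>Q. p \<beta> * t \<alpha> * (\<Sum>I\<in>A. \<Sum>J\<in>A. E \<beta> I * E \<alpha> J * g I J))"
    by (simp add: sum_distrib_left mult_ac flip: sum.cartesian_product)
  finally show ?thesis .
qed

text \<open>The contraction factors over the slots, and in each slot the metric pairs two coordinate
  fields.\<close>

lemma sum_partial_multi_metric_multi:
  fixes x :: "real^'n::{finite,linorder} \<Rightarrow> real^'m"
  assumes "x differentiable at u"
  shows "(\<Sum>I\<in>multi_indices (CARD('n) - 1). \<Sum>J\<in>multi_indices (CARD('n) - 1).
      partial_multi x u bs I * partial_multi x u as J * metric_multi (CARD('n) - 1) (G (x u)) I J) =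
    (\<Prod>k<CARD('n) - 1. induced_metric G x u $ (bs ! k) $ (as ! k))"
proof -
  let ?l = "CARD('n) - 1" and ?f = "\<lambda>k i j. partial (bs ! k) x u $ i * partial (as ! k) x u $ j * G (x u) $ i $ j"
  have "(\<Sum>I\<in>multi_indices ?l. \<Sum>J\<in>multi_indices ?l.
      partial_multi x u bs I * partial_multi x u as J * metric_multi ?l (G (x u)) I J) =
    (\<Sum>I\<in>multi_indices ?l. \<Sum>J\<in>multi_indices ?l. \<Prod>k<?l. ?f k (I ! k) (J ! k))"
    by (simp add: partial_multi_def metric_multi_def partial_component[OF assms] prod.distrib)
  also have "\<dots> = (\<Sum>I\<in>multi_indices ?l. \<Prod>k<?l. \<Sum>j\<in>UNIV. ?f k (I ! k) j)"
    by (intro sum.cong refl sum_multi_indices_prod)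
  also have "\<dots> = (\<Prod>k<?l. \<Sum>i\<in>UNIV. \<Sum>j\<in>UNIV. ?f k i j)"
    by (rule sum_multi_indices_prod)
  also have "\<dots> = (\<Prod>k<?l. induced_metric G x u $ (bs ! k) $ (as ! k))"
    by (simp add: induced_metric_def metric_form_def mult_ac)
  finally show ?thesis .
qed

lemma CARD_eq_Suc: "CARD('n::finite) = Suc (CARD('n) - 1)"
  by simp

text \<open>Splitting off the first bracket index gives the same shape as in
  \<open>T_tensor_eq\<close>, as \<open>sum_contract\<close> requires.\<close>

lemma P_tensor_eq:
  fixes x :: "real^'n::{finite,linorder} \<Rightarrow> real^'m"
  assumes x: "x differentiable at u" and I: "I \<in> multi_indices (CARD('n) - 1)"
  shows "P_tensor x r u i I = 1 / (sqrt (fact (CARD('n) - 1)) * r u) *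
    (\<Sum>(b, bs)\<in>UNIV \<times> multi_indices (CARD('n) - 1).
      list_sign (b # bs) * partial b x u $ i * partial_multi x u bs I)"
proof -
  let ?l = "CARD('n) - 1"
  have "(\<Sum>as\<in>multi_indices CARD('n). levi_civita as *
        (\<Prod>k<CARD('n). partial (as ! k) (map (\<lambda>j v. x v $ j) (i # I) ! k) u)) =
      (\<Sum>as\<in>multi_indices CARD('n). list_sign as *
        (\<Prod>k<CARD('n). partial (as ! k) x u $ ((i # I) ! k)))"
  proof (intro sum.cong refl arg_cong2[of _ _ _ _ "(*)"] prod.cong)
    fix as :: "'n list" assume "as \<in> multi_indices CARD('n)"
    then show "levi_civita as = list_sign as" by (simp add: multi_indices_def levi_civita_eq_list_sign)
  next
    fix as :: "'n list" and k assume "k \<in> {..<CARD('n)}"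
    then have "k < length (i # I)" using I by (simp add: multi_indices_def)
    then show "partial (as ! k) (map (\<lambda>j v. x v $ j) (i # I) ! k) u = partial (as ! k) x u $ ((i # I) ! k)"
      by (simp only: nth_map partial_component[OF x])
  qed
  also have "\<dots> = (\<Sum>as\<in>multi_indices (Suc ?l). list_sign as *
        (\<Prod>k<Suc ?l. partial (as ! k) x u $ ((i # I) ! k)))"
    by (simp only: CARD_eq_Suc[symmetric])
  also have "\<dots> = (\<Sum>b\<in>UNIV. \<Sum>bs\<in>multi_indices ?l.
      list_sign (b # bs) * partial b x u $ i * partial_multi x u bs I)"
    unfolding sum_multi_indices_Suc prod.lessThan_Suc_shift
    by (simp add: partial_multi_def partial_component[OF x] mult_ac)
  finally show ?thesis
    by (simp add: P_tensor_def nambu_bracket_def sum.cartesian_product)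
qed

text \<open>Rotating the derivative index to the front costs (-1)^(n-1); together with the prefactor
  (-1)^n a single minus sign remains.\<close>

lemma T_tensor_eq:
  fixes x :: "real^'n::{finite,linorder} \<Rightarrow> real^'m"
  shows "T_tensor G x r V u J j = - 1 / (sqrt (fact (CARD('n) - 1)) * r u) *
    (\<Sum>(a, as)\<in>UNIV \<times> multi_indices (CARD('n) - 1).
      list_sign (a # as) * cov_deriv G x a V u $ j * partial_multi x u as J)"
proof -
  let ?l = "CARD('n) - 1"
  have "(\<Sum>as\<in>multi_indices ?l. \<Sum>a\<in>UNIV.
        levi_civita (as @ [a]) / r u * partial_multi x u as J * cov_deriv G x a V u $ j) =
      (\<Sum>as\<in>multi_indices ?l. \<Sum>a\<in>UNIV. (-1) ^ ?l / r u *
        (list_sign (a # as) * cov_deriv G x a V u $ j * partial_multi x u as J))"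
    by (intro sum.cong refl)
      (simp add: multi_indices_def levi_civita_eq_list_sign list_sign_cyclic del: list_sign.simps)
  also have "\<dots> = (-1) ^ ?l / r u * (\<Sum>a\<in>UNIV. \<Sum>as\<in>multi_indices ?l.
        list_sign (a # as) * cov_deriv G x a V u $ j * partial_multi x u as J)"
    by (subst sum.swap) (simp add: sum_distrib_left del: list_sign.simps)
  finally have "T_tensor G x r V u J j = ((-1) ^ CARD('n) * (-1) ^ ?l) / (sqrt (fact ?l) * r u) *
      (\<Sum>a\<in>UNIV. \<Sum>as\<in>multi_indices ?l.
        list_sign (a # as) * cov_deriv G x a V u $ j * partial_multi x u as J)"
    by (simp add: T_tensor_def del: list_sign.simps)
  moreover have "(-1) ^ CARD('n) * (-1) ^ ?l = (-1 :: real)"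
    by (subst (1) CARD_eq_Suc) (simp flip: power_add mult_2)
  ultimately show ?thesis
    by (simp only: sum.cartesian_product)
qed

lemma B_tensor_eq:
  fixes x :: "real^'n::{finite,linorder} \<Rightarrow> real^'m"
  assumes x: "x differentiable at u"
  shows "B_tensor G x r V u i k = - 1 / (fact (CARD('n) - 1) * (r u)\<^sup>2) *
    (\<Sum>\<beta>\<in>UNIV \<times> multi_indices (CARD('n) - 1). \<Sum>\<alpha>\<in>UNIV \<times> multi_indices (CARD('n) - 1).
      (list_sign (fst \<beta> # snd \<beta>) * partial (fst \<beta>) x u $ i) * (list_sign (fst \<alpha> # snd \<alpha>) * cov_deriv G x (fst \<alpha>) V u $ k) *
      (\<Prod>k<CARD('n) - 1. induced_metric G x u $ (snd \<beta> ! k) $ (snd \<alpha> ! k)))"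
proof -
  let ?l = "CARD('n) - 1" and ?c = "1 / (sqrt (fact (CARD('n) - 1)) * r u)"
  let ?Q = "UNIV \<times> multi_indices ?l :: ('n \<times> 'n list) set"
  let ?p = "\<lambda>\<beta>. list_sign (fst \<beta> # snd \<beta>) * partial (fst \<beta>) x u $ i"
  let ?t = "\<lambda>\<alpha>. list_sign (fst \<alpha> # snd \<alpha>) * cov_deriv G x (fst \<alpha>) V u $ k"
  let ?E = "\<lambda>\<alpha> I. partial_multi x u (snd \<alpha>) I"
  have "B_tensor G x r V u i k = (\<Sum>I\<in>multi_indices ?l. \<Sum>J\<in>multi_indices ?l. (- ?c * ?c) *
      ((\<Sum>\<beta>\<in>?Q. ?p \<beta> * ?E \<beta> I) * (\<Sum>\<alpha>\<in>?Q. ?t \<alpha> * ?E \<alpha> J) * metric_multi ?l (G (x u)) I J))"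
    unfolding B_tensor_def T_tensor_eq split_beta
    by (intro sum.cong refl, subst P_tensor_eq[OF x]) (auto simp: split_beta simp del: list_sign.simps)
  also have "\<dots> = (- ?c * ?c) * (\<Sum>\<beta>\<in>?Q. \<Sum>\<alpha>\<in>?Q. ?p \<beta> * ?t \<alpha> *
      (\<Prod>k<?l. induced_metric G x u $ (snd \<beta> ! k) $ (snd \<alpha> ! k)))"
    unfolding sum_distrib_left[symmetric] sum_contract sum_partial_multi_metric_multi[OF x] ..
  \<comment> \<open>The two square roots multiply to (n-1)!, which
    \<open>sum_list_sign_contract\<close> cancels later.\<close>
  also have "- ?c * ?c = - 1 / (fact ?l * (r u)\<^sup>2)"
    by (simp add: power2_eq_square)
  finally show ?thesis .
qed

text \<open>Pairing with the tangent vector supplies the missing n-th entry of the induced metric.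
  The sum over \<open>\<beta>\<close> then is a determinant by \<open>sum_list_sign_prod\<close>,
  and the sum over the list in \<open>\<alpha>\<close> is (n-1)! times a Kronecker delta by
  \<open>sum_list_sign_contract\<close>.\<close>

lemma metric_form_B_map:
  fixes x :: "real^'n::{finite,linorder} \<Rightarrow> real^'m"
  assumes x: "x differentiable at u"
  shows "metric_form (G (x u)) (B_map G x r V u Y) (tangent_vector x u \<xi>) =
    - det (induced_metric G x u) / (r u)\<^sup>2 *
      (\<Sum>a\<in>UNIV. \<xi> $ a * metric_form (G (x u)) (cov_deriv G x a V u) Y)"
proof -
  let ?l = "CARD('n) - 1" and ?g = "induced_metric G x u"
  let ?Q = "UNIV \<times> multi_indices ?l :: ('n \<times> 'n list) set"
  define K where "K = - 1 / (fact ?l * (r u)\<^sup>2)"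
  let ?s = "\<lambda>\<beta> :: 'n \<times> 'n list. list_sign (fst \<beta> # snd \<beta>)"
  let ?\<mu> = "\<lambda>a. metric_form (G (x u)) (cov_deriv G x a V u) Y"
  let ?q = "\<lambda>\<beta> \<alpha>. ?s \<beta> * ?s \<alpha> * (\<Prod>k<?l. ?g $ (snd \<beta> ! k) $ (snd \<alpha> ! k))"
  \<comment> \<open>The free index sits on a coordinate field only, so the image is tangent and its
    pairing with a tangent vector involves the induced metric alone.\<close>
  have "B_map G x r V u Y = K *\<^sub>R (\<Sum>\<beta>\<in>?Q. \<Sum>\<alpha>\<in>?Q. (?q \<beta> \<alpha> * ?\<mu> (fst \<alpha>)) *\<^sub>R partial (fst \<beta>) x u)"
  proof (subst vec_eq_iff, intro allI)
    fix i
    have "B_map G x r V u Y $ i = (\<Sum>(k, j)\<in>UNIV \<times> UNIV. \<Sum>(\<beta>, \<alpha>)\<in>?Q \<times> ?Q.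
        K * (?q \<beta> \<alpha> * partial (fst \<beta>) x u $ i * (cov_deriv G x (fst \<alpha>) V u $ k * G (x u) $ k $ j * Y $ j)))"
      by (simp add: B_map_def B_tensor_eq[OF x, where r = r, folded K_def] sum_distrib_left sum_distrib_right mult_ac
          del: list_sign.simps UNIV_Times_UNIV flip: sum.cartesian_product)
    also have "\<dots> = (\<Sum>(\<beta>, \<alpha>)\<in>?Q \<times> ?Q. \<Sum>(k, j)\<in>UNIV \<times> UNIV.
        K * (?q \<beta> \<alpha> * partial (fst \<beta>) x u $ i * (cov_deriv G x (fst \<alpha>) V u $ k * G (x u) $ k $ j * Y $ j)))"
      unfolding split_beta by (rule sum.swap)
    also have "\<dots> = (K *\<^sub>R (\<Sum>\<beta>\<in>?Q. \<Sum>\<alpha>\<in>?Q. (?q \<beta> \<alpha> * ?\<mu> (fst \<alpha>)) *\<^sub>R partial (fst \<beta>) x u)) $ i"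
      by (simp add: metric_form_def sum_distrib_left sum_distrib_right mult_ac
          del: list_sign.simps UNIV_Times_UNIV flip: sum.cartesian_product)
    finally show "B_map G x r V u Y $ i = \<dots>" .
  qed
  moreover have "metric_form (G (x u)) (partial b x u) (tangent_vector x u \<xi>) = (\<Sum>c\<in>UNIV. \<xi> $ c * ?g $ b $ c)" for b
    by (simp add: metric_form_simps tangent_vector_def induced_metric_def)
  ultimately have "metric_form (G (x u)) (B_map G x r V u Y) (tangent_vector x u \<xi>) =
      K * (\<Sum>\<beta>\<in>?Q. \<Sum>\<alpha>\<in>?Q. ?q \<beta> \<alpha> * ?\<mu> (fst \<alpha>) * (\<Sum>c\<in>UNIV. \<xi> $ c * ?g $ fst \<beta> $ c))"
    by (simp only: metric_form_simps(5,7))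
  also have "(\<Sum>\<beta>\<in>?Q. \<Sum>\<alpha>\<in>?Q. ?q \<beta> \<alpha> * ?\<mu> (fst \<alpha>) * (\<Sum>c\<in>UNIV. \<xi> $ c * ?g $ fst \<beta> $ c)) =
      (\<Sum>\<alpha>\<in>?Q. \<Sum>\<beta>\<in>?Q. \<Sum>c\<in>UNIV. ?q \<beta> \<alpha> * ?\<mu> (fst \<alpha>) * (\<xi> $ c * ?g $ fst \<beta> $ c))"
    unfolding sum_distrib_left by (rule sum.swap)
  also have "\<dots> = (\<Sum>\<alpha>\<in>?Q. \<Sum>c\<in>UNIV. \<Sum>\<beta>\<in>?Q. ?q \<beta> \<alpha> * ?\<mu> (fst \<alpha>) * (\<xi> $ c * ?g $ fst \<beta> $ c))"
    by (intro sum.cong refl sum.swap)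
  \<comment> \<open>For fixed \<open>\<alpha>\<close> and \<open>c\<close> the lists
    \<open>fst \<beta> # snd \<beta>\<close> run through all full multi-indices, and
    \<open>c # snd \<alpha>\<close> selects the columns.\<close>
  also have "\<dots> = (\<Sum>\<alpha>\<in>?Q. \<Sum>c\<in>UNIV. ?s \<alpha> * ?\<mu> (fst \<alpha>) * \<xi> $ c * (det ?g * list_sign (c # snd \<alpha>)))"
  proof (intro sum.cong refl)
    fix \<alpha> and c :: 'n assume \<alpha>: "\<alpha> \<in> ?Q"
    have "(\<Sum>\<beta>\<in>?Q. ?s \<beta> * ?g $ fst \<beta> $ c * (\<Prod>k<?l. ?g $ (snd \<beta> ! k) $ (snd \<alpha> ! k))) =
        (\<Sum>bs\<in>multi_indices (Suc ?l). list_sign bs * (\<Prod>k<Suc ?l. ?g $ (bs ! k) $ ((c # snd \<alpha>) ! k)))"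
      unfolding sum_multi_indices_Suc prod.lessThan_Suc_shift
      by (simp add: sum.cartesian_product split_beta mult_ac del: list_sign.simps)
    also have "\<dots> = det ?g * list_sign (c # snd \<alpha>)"
      unfolding CARD_eq_Suc[symmetric]
      by (rule sum_list_sign_prod) (use \<alpha> in \<open>auto simp: multi_indices_def\<close>)
    finally have "det ?g * list_sign (c # snd \<alpha>) =
        (\<Sum>\<beta>\<in>?Q. ?s \<beta> * ?g $ fst \<beta> $ c * (\<Prod>k<?l. ?g $ (snd \<beta> ! k) $ (snd \<alpha> ! k)))" ..
    then show "(\<Sum>\<beta>\<in>?Q. ?q \<beta> \<alpha> * ?\<mu> (fst \<alpha>) * (\<xi> $ c * ?g $ fst \<beta> $ c)) =
        ?s \<alpha> * ?\<mu> (fst \<alpha>) * \<xi> $ c * (det ?g * list_sign (c # snd \<alpha>))"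
      by (simp add: sum_distrib_left mult_ac del: list_sign.simps)
  qed
  also have "\<dots> = (\<Sum>a\<in>UNIV. \<Sum>c\<in>UNIV. \<Sum>as\<in>multi_indices ?l.
      det ?g * (\<xi> $ c * ?\<mu> a) * (list_sign (a # as) * list_sign (c # as)))"
    by (subst sum.swap[of _ "multi_indices ?l"])
      (simp add: sum.cartesian_product' mult_ac del: list_sign.simps)
  \<comment> \<open>The Kronecker delta removes the sum over \<open>c\<close>; the factorial cancels
    against \<open>K\<close>.\<close>
  also have "\<dots> = (\<Sum>a\<in>UNIV. det ?g * (\<xi> $ a * ?\<mu> a) * fact ?l)"
    unfolding sum_distrib_left[symmetric] sum_list_sign_contract
    by (simp add: if_distrib[of "(*) _"] cong: if_cong)
  also have "K * \<dots> = - det ?g / (r u)\<^sup>2 * (\<Sum>a\<in>UNIV. \<xi> $ a * ?\<mu> a)"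
    by (simp add: K_def flip: sum_distrib_left sum_distrib_right)
  finally show ?thesis .
qed

section \<open>The normal connection in an orthonormal frame\<close>

text \<open>Pairing with the frame recovers the normal coefficients, so tangential and normal
  coefficients together map injectively into the ambient space, and by equality of dimensions onto
  it.\<close>

lemma normal_frame_decomposition:
  fixes E :: "real^'n \<Rightarrow> real^'m" and N :: "'p::finite \<Rightarrow> real^'m"
  assumes E: "linear E" "inj E" and card: "CARD('m) = CARD('n) + CARD('p)"
    and orth: "\<And>A B. metric_form G (N A) (N B) = (if A = B then 1 else 0)"
    and perp: "\<And>A \<xi>. metric_form G (N A) (E \<xi>) = 0"
  shows "\<exists>\<xi>. v = E \<xi> + (\<Sum>B\<in>UNIV. metric_form G (N B) v *\<^sub>R N B)"
proof -
  \<comment> \<open>The sum type gives the source dimension n + p: \<open>Inl\<close> holds the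
    tangential coefficients, \<open>Inr\<close> the normal ones.\<close>
  define f where "f w = E (\<chi> a. w $ Inl a) + (\<Sum>B\<in>UNIV. w $ Inr B *\<^sub>R N B)" for w :: "real^('n + 'p)"
  have coeff: "metric_form G (N B) (f w) = w $ Inr B" for w B
    by (simp add: f_def metric_form_simps perp orth if_distrib cong: if_cong)
  have lin: "linear f"
  proof (rule linearI)
    fix w w' :: "real^('n + 'p)" and a :: real
    have "(\<chi> a. (w + w') $ Inl a) = (\<chi> a. w $ Inl a) + (\<chi> a. w' $ Inl a)"
      "(\<chi> i. (a *\<^sub>R w) $ Inl i) = a *\<^sub>R (\<chi> i. w $ Inl i)"
      by (simp_all add: vec_eq_iff)
    then show "f (w + w') = f w + f w'" "f (a *\<^sub>R w) = a *\<^sub>R f w"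
      using E(1) by (simp_all add: f_def linear_add linear_scale scaleR_left_distrib sum.distrib
          scaleR_right_distrib scaleR_sum_right)
  qed
  have "w = 0" if "f w = 0" for w
  proof -
    have "w $ Inr B = 0" for B using coeff[of B w] that by (simp add: metric_form_simps)
    moreover from this have "E (\<chi> a. w $ Inl a) = 0" using that by (simp add: f_def)
    then have "(\<chi> a. w $ Inl a) = 0" using E linear_injective_0 by blast
    then have "w $ Inl a = 0" for a by (simp add: vec_eq_iff)
    ultimately show ?thesis unfolding vec_eq_iff by (metis sum.exhaust zero_index)
  qed
  then have "inj f" using lin linear_injective_0 by blast
  then have "surj f"
    using lin card by (intro linear_injective_imp_surjective) (auto simp: card_UNIV_sum)
  then obtain w where "v = f w" by (metis surjD)
  then show ?thesis using coeff[of _ w] by (auto simp: f_def)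
qed

text \<open>Both definite descriptions have to be shown to denote. The normal component exists by
  \<open>normal_frame_decomposition\<close> and is unique by positive definiteness; its coefficients
  are unique by orthonormality.\<close>

lemma normal_conn_eq:
  fixes x :: "real^'n \<Rightarrow> real^'m" and N :: "'p::finite \<Rightarrow> real^'n \<Rightarrow> real^'m"
  assumes x: "(x has_derivative x') (at u)" "inj x'" and card: "CARD('m) = CARD('n) + CARD('p)"
    and pos: "\<And>v. v \<noteq> 0 \<Longrightarrow> metric_form (G (x u)) v v > 0"
    and sym: "transpose (G (x u)) = G (x u)"
    and orth: "\<And>A B. metric_form (G (x u)) (N A u) (N B u) = (if A = B then 1 else 0)"
    and perp: "\<And>A t. t \<in> tangent_space x u \<Longrightarrow> metric_form (G (x u)) (N A u) t = 0"
  shows "normal_conn G x N \<xi> u A B =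
    metric_form (G (x u)) (\<Sum>a\<in>UNIV. \<xi> $ a *\<^sub>R cov_deriv G x a (N A) u) (N B u)"
proof -
  let ?g = "metric_form (G (x u))"
  let ?v = "\<Sum>a\<in>UNIV. \<xi> $ a *\<^sub>R cov_deriv G x a (N A) u"
  let ?w = "\<Sum>B\<in>UNIV. ?g (N B u) ?v *\<^sub>R N B u"
  have lin: "linear x'" using x(1) by (rule has_derivative_linear)
  have T: "tangent_space x u = range x'" using x(1) by (rule tangent_space_eq_range)
  have perp': "?g (N A u) (x' \<zeta>) = 0" for A \<zeta> using perp T by simp
  obtain \<zeta> where "?v = x' \<zeta> + ?w"
    using normal_frame_decomposition[OF lin x(2) card orth perp', of ?v] by blast
  then have "?v - ?w = x' \<zeta>" by (simp only: diff_eq_eq)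
  then have w: "?v - ?w \<in> tangent_space x u" by (metis T rangeI)
  have w_perp: "?g ?w t = 0" if "t \<in> tangent_space x u" for t
    by (simp add: metric_form_simps(5,7) perp[OF that])
  have deriv: "normal_deriv G x \<xi> (N A) u = ?w"
    unfolding normal_deriv_def normal_component_def
  proof (rule the_equality)
    show "?v - ?w \<in> tangent_space x u \<and> (\<forall>t\<in>tangent_space x u. ?g ?w t = 0)"
      using w w_perp by blast
  next
    fix w' assume w': "?v - w' \<in> tangent_space x u \<and> (\<forall>t\<in>tangent_space x u. ?g w' t = 0)"
    \<comment> \<open>Two candidates differ by a vector that is tangent and orthogonal to all
      tangent vectors, hence of length 0.\<close>
    then have "(?v - w') - (?v - ?w) \<in> tangent_space x u"
      using w unfolding tangent_space_def by (blast intro: span_diff)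
    then have t: "?w - w' \<in> tangent_space x u" by simp
    then have "?g (?w - w') (?w - w') = 0"
      using w_perp[OF t] w' t by (simp add: metric_form_simps(3))
    then show "w' = ?w" using pos[of "?w - w'"] by fastforce
  qed
  have unique: "c = (\<lambda>B. ?g (N B u) ?v)" if "?w = (\<Sum>B\<in>UNIV. c B *\<^sub>R N B u)" for c
  proof
    fix B
    have "?g ?w (N B u) = ?g (\<Sum>B\<in>UNIV. c B *\<^sub>R N B u) (N B u)" using that by simp
    then show "c B = ?g (N B u) ?v" by (simp add: metric_form_simps(5,7) orth if_distrib cong: if_cong)
  qed
  have "normal_conn G x N \<xi> u A = (\<lambda>B. ?g (N B u) ?v)"
    unfolding normal_conn_def deriv by (rule the_equality[OF refl unique])
  then show ?thesis by (simp only: metric_form_sym[OF sym, of "N B u"])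
qed

section \<open>Charts and the identity at a point of the submanifold\<close>

lemma smooth_on_imp_differentiable: "smooth_on S f \<Longrightarrow> u \<in> S \<Longrightarrow> f differentiable at u"
  unfolding smooth_on_def using Ck_on.simps(2)[of 0 f S] by blast

text \<open>Transfers positive definiteness to the induced metric, since an immersion sends nonzero
  \<open>\<xi>\<close> to nonzero tangent vectors.\<close>

lemma metric_form_induced_metric:
  "metric_form (induced_metric G x u) \<xi> \<xi> =
    metric_form (G (x u)) (tangent_vector x u \<xi>) (tangent_vector x u \<xi>)"
  by (subst metric_form_def, simp only: tangent_vector_def metric_form_simps(7))
    (simp add: induced_metric_def metric_form_simps sum_distrib_left mult_ac)

lemma chart_inv_apply:
  assumes "smooth_manifold M \<A>" "c \<in> \<A>" "p \<in> fst c"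
  shows "chart_inv c (snd c p) = p"
proof -
  have "openin M (fst c)" "homeomorphic_map (subtopology M (fst c)) (top_of_set (snd c ` fst c)) (snd c)"
    using assms by (auto simp: smooth_manifold_def)
  then have "inj_on (snd c) (fst c)"
    by (metis homeomorphic_imp_injective_map inf.absorb2 openin_subset topspace_subtopology)
  then show ?thesis using assms(3) by (simp add: chart_inv_def)
qed

lemma open_chart_image:
  assumes "smooth_manifold M \<A>" "c \<in> \<A>" "openin M U" "U \<subseteq> fst c"
  shows "open (snd c ` U)"
proof -
  have hom: "homeomorphic_map (subtopology M (fst c)) (top_of_set (snd c ` fst c)) (snd c)"
    and "open (snd c ` fst c)"
    using assms by (auto simp: smooth_manifold_def)
  moreover have "openin (subtopology M (fst c)) U"
    using assms(3,4) by (simp add: openin_subtopology_Int2 inf.absorb2 openin_subtopology) blast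
  ultimately show ?thesis
    using homeomorphic_imp_open_map[OF hom] openin_open_trans unfolding open_map_def by blast
qed

theorem proposition3p6:
  fixes M :: "'a topology" and \<A> :: "('a, 'm::finite) chart set"
    and G :: "('a, 'm) chart \<Rightarrow> real^'m \<Rightarrow> real^'m^'m"
    and S :: "'b topology" and \<B> :: "('b, 'n::{finite,linorder}) chart set"
    and \<iota> :: "'b \<Rightarrow> 'a" and \<rho> :: "('b, 'n) chart \<Rightarrow> real^'n::{finite,linorder} \<Rightarrow> real"
    and W :: "'b set" and N :: "'p::finite \<Rightarrow> ('a, 'm) chart \<Rightarrow> 'b \<Rightarrow> real^'m"
    and c :: "('a, 'm) chart" and d :: "('b, 'n) chart" and q :: 'b
    and \<xi> :: "real^'n::{finite,linorder}" and A B :: 'p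
  assumes "CARD('n) \<ge> 2" and "CARD('m) = CARD('n) + CARD('p)"
    and "smooth_manifold M \<A>" and "riemannian_metric \<A> G"
    and "smooth_manifold S \<B>" and "smooth_embedding S \<B> M \<A> \<iota>"
    and "nonvanishing_density \<B> \<rho>"
    and "normal_frame S \<B> \<A> G \<iota> W N"
    and "c \<in> \<A>" and "d \<in> \<B>" and "q \<in> W" and "q \<in> fst d" and "\<iota> q \<in> fst c"
  defines "x \<equiv> local_rep \<iota> c d" and "u \<equiv> snd d q"
    and "n \<equiv> (\<lambda>C v. N C c (chart_inv d v))"
  shows "metric_form (G c (x u)) (B_map (G c) x (\<rho> d) (n B) u (n A u)) (tangent_vector x u \<xi>) =
         (density_ratio (G c) x (\<rho> d) u)\<^sup>2 * normal_conn (G c) x n \<xi> u A B"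
proof -
  let ?U = "{p \<in> fst d \<inter> W. \<iota> p \<in> fst c}"
  let ?V = "snd d ` ?U"
  let ?g = "metric_form (G c (x u))"
  have inv: "chart_inv d (snd d p) = p" if "p \<in> fst d" for p
    using chart_inv_apply[OF assms(5) \<open>d \<in> \<B>\<close> that] .
  have x_apply: "x (snd d p) = snd c (\<iota> p)" if "p \<in> fst d" for p
    using that by (simp add: x_def local_rep_def inv)
  have uV: "u \<in> ?V" using assms by auto
  have emb: "embedding_map S M \<iota>"
    and emb_x: "smooth_on (snd d ` {p \<in> fst d. \<iota> p \<in> fst c}) x"
      "\<And>v. v \<in> snd d ` {p \<in> fst d. \<iota> p \<in> fst c} \<Longrightarrow> inj ((*v) (jacobian x (at v)))"
    using \<open>smooth_embedding S \<B> M \<A> \<iota>\<close> \<open>c \<in> \<A>\<close> \<open>d \<in> \<B>\<close>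
    by (auto simp: smooth_embedding_def x_def Let_def)
  \<comment> \<open>Continuity of \<open>\<iota>\<close> makes the common domain of both charts and
    the frame open, so the relations in \<open>orth\<close> hold near \<open>u\<close> and can be
    differentiated there.\<close>
  have "open ?V"
  proof (rule open_chart_image[OF assms(5) \<open>d \<in> \<B>\<close>])
    have "continuous_map S M \<iota>"
      using emb by (meson embedding_map_def continuous_map_in_subtopology homeomorphic_imp_continuous_map)
    moreover have "openin M (fst c)" "openin S (fst d)" "openin S W"
      using assms by (auto simp: smooth_manifold_def normal_frame_def)
    ultimately have "openin S (fst d \<inter> W \<inter> {p \<in> topspace S. \<iota> p \<in> fst c})"
      by (intro openin_Int openin_continuous_map_preimage)
    moreover have "fst d \<inter> W \<inter> {p \<in> topspace S. \<iota> p \<in> fst c} = ?U"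
      using \<open>openin S (fst d)\<close> openin_subset by fastforce
    ultimately show "openin S ?U" by simp
  qed auto
  have xdiff: "x differentiable at u"
    using smooth_on_imp_differentiable[OF emb_x(1)] uV by blast
  then have x': "(x has_derivative (*v) (jacobian x (at u))) (at u)"
    by (simp add: jacobian_works)
  have inj: "inj ((*v) (jacobian x (at u)))" using emb_x(2) uV by blast
  have y: "x u \<in> snd c ` fst c" using x_apply assms by (auto simp: u_def)
  have open_c: "open (snd c ` fst c)"
    using assms(3) \<open>c \<in> \<A>\<close> by (auto simp: smooth_manifold_def)
  have sym: "transpose (G c y) = G c y" if "y \<in> snd c ` fst c" for y
    using assms that by (auto simp: riemannian_metric_def)
  have pos: "?g v v > 0" if "v \<noteq> 0" for v
    using assms that y by (auto simp: riemannian_metric_def)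
  have Gdiff: "G c differentiable at (x u)"
    using smooth_on_imp_differentiable[OF _ y, of "G c"] assms by (auto simp: riemannian_metric_def)
  have ndiff: "n C differentiable at u" for C
    using smooth_on_imp_differentiable[OF _ uV, of "n C"] assms by (auto simp: normal_frame_def n_def)
  have "metric_form (G c (snd c (\<iota> p))) (N C c p) (N D c p) = (if C = D then 1 else 0)"
    if "p \<in> W" "\<iota> p \<in> fst c" for C D p
    using \<open>normal_frame S \<B> \<A> G \<iota> W N\<close> \<open>c \<in> \<A>\<close> that unfolding normal_frame_def by meson
  then have orth: "metric_form (G c (x v)) (n C v) (n D v) = (if C = D then 1 else 0)" if "v \<in> ?V" for C D v
    using that by (auto simp: n_def inv x_apply)
  have "metric_form (G c (snd c (\<iota> q))) (N C c q) t = 0"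
    if "t \<in> tangent_space (local_rep \<iota> c d) (snd d q)" for C t
    using \<open>normal_frame S \<B> \<A> G \<iota> W N\<close> \<open>c \<in> \<A>\<close> \<open>d \<in> \<B>\<close> that assms(11-13)
    unfolding normal_frame_def by blast
  then have perp: "?g (n C u) t = 0" if "t \<in> tangent_space x u" for C t
    using that \<open>q \<in> fst d\<close> x_apply[of q] unfolding n_def u_def x_def by (simp add: inv)
  \<comment> \<open>The pairing of the two normal fields is constant near \<open>u\<close>, so
    metric compatibility leaves two terms with sum 0.\<close>
  have antisym: "?g (cov_deriv (G c) x a (n A) u) (n B u) = - ?g (cov_deriv (G c) x a (n B) u) (n A u)" for a
  proof -
    have "((\<lambda>v. metric_form (G c (x v)) (n A v) (n B v)) has_derivative (\<lambda>h. 0)) (at u)"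
      using orth by (intro has_derivative_transform_within_open[OF has_derivative_const \<open>open ?V\<close> uV]) simp
    then have "partial a (\<lambda>v. metric_form (G c (x v)) (n A v) (n B v)) u = 0"
      by (rule partial_eq_derivative)
    moreover have "\<forall>\<^sub>F y in nhds (x u). transpose (G c y) = G c y"
      unfolding eventually_nhds using open_c y sym by (intro exI[of _ "snd c ` fst c"]) simp
    ultimately show ?thesis
      using cov_deriv_metric_compatible[OF Gdiff xdiff ndiff[of A] ndiff[of B], of a] invertible_of_positive[OF pos]
        metric_form_sym[OF sym[OF y], of "n A u"] by simp
  qed
  \<comment> \<open>The sign produced by \<open>antisym\<close> matches the one in
    \<open>metric_form_B_map\<close>.\<close>
  have conn: "normal_conn (G c) x n \<xi> u A B = - (\<Sum>a\<in>UNIV. \<xi> $ a * ?g (cov_deriv (G c) x a (n B) u) (n A u))"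
    using normal_conn_eq[where G = "G c" and x = x and N = n and u = u and \<xi> = \<xi> and A = A and B = B,
        OF x' inj assms(2) pos sym[OF y] orth[OF uV] perp]
    by (simp add: metric_form_simps antisym sum_negf)
  \<comment> \<open>Positivity of the determinant is needed for the square of the root in
    \<open>density_ratio\<close> to return it.\<close>
  have "metric_form (induced_metric (G c) x u) v v > 0" if "v \<noteq> 0" for v
  proof -
    have "jacobian x (at u) *v v \<noteq> 0"
      using inj that by (metis injD matrix_vector_mult_0_right)
    then show ?thesis
      using pos by (simp add: metric_form_induced_metric tangent_vector_eq_derivative[OF x'])
  qed
  then have "det (induced_metric (G c) x u) > 0" by (rule det_positive)
  then show ?thesis
    by (simp add: metric_form_B_map[OF xdiff] conn density_ratio_def power_divide)
qed

end
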